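(* Let $\Omega$ be a countably infinite set, let $G\leq\mathrm{Sym}(\Omega)$ be a transitive, closed permutation group without algebraicity and let $Z$ be a standard Borel space. Let $\mu$ be a $G$-invariant, Borel, ergodic probability measure on $Z^\Omega$. Then $\mu$ is dissociated if and only if $\mu=\lambda^{\otimes\Omega}$ for some Borel probability measure $\lambda$ on $Z$.
   Context: $\mathrm{Sym}(\Omega)$ is the group of all permutations of the countably infinite set $\Omega$ with the topology of pointwise convergence; a closed permutation group is a closed subgroup of $\mathrm{Sym}(\Omega)$. For $A\subseteq\Omega$, $G_A=\{g\in G: g(a)=a\text{ for all }a\in A\}$. $G$ has no algebraicity if for every finite $A\subseteq\Omega$ all orbits of $G_A$ on $\Omega\setminus A$ are infinite. $G$ acts on $Z^\Omega$ by $g\cdot(z_\omega)_{\omega\in\Omega}=(z_{g^{-1}(\omega)})_{\omega\in\Omega}$. For a $G$-invariant Borel probability measure $\mu$ on $X=Z^\Omega$ and finite $A\subseteq\Omega$, let $\mathcal{F}_A$ be the $\sigma$-algebra of measurable $Y\subseteq X$ with $\mu(gY\triangle Y)=0$ for all $g\in G_A$. The measure $\mu$ is ergodic if $\mu(Y)\in\{0,1\}$ for all $Y\in\mathcal{F}_\emptyset$. The measure $\mu$ (equivalently the action $G\curvearrowright(Z^\Omega,\mu)$) is called dissociated if for all finite $A,B\subseteq\Omega$, $\mathcal{F}_A$ and $\mathcal{F}_B$ are independent conditionally on $\mathcal{F}_{A\cap B}$, i.e. $\mathbb{E}[f\mid\mathcal{F}_A]=\mathbb{E}[f\mid\mathcal{F}_{A\cap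 B}]$ for every $\mathcal{F}_B$-measurable $f\in L^2(X,\mu)$. *)

theory Defs
  imports "HOL-Probability.Probability" "HOL-Algebra.Group_Action"
begin

section \<open>Closed permutation groups\<close>

text \<open>
  The group of all permutations of \<open>\<Omega>\<close> is \<^term>\<open>BijGroup \<Omega>\<close>; its elements are the
  \<^emph>\<open>extensional\<close> bijections of \<open>\<Omega>\<close>.  Pointwise convergence is taken with respect to the
  discrete topology on \<open>\<Omega>\<close>.
\<close>

definition pointwise_topology :: "'w set \<Rightarrow> ('w \<Rightarrow> 'w) topology" where
  "pointwise_topology \<Omega> =
     subtopology (product_topology (\<lambda>_. discrete_topology \<Omega>) \<Omega>) (carrier (BijGroup \<Omega>))"

definition closed_permutation_group :: "'w set \<Rightarrow> ('w \<Rightarrow> 'w) set \<Rightarrow> bool" where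
  "closed_permutation_group \<Omega> G \<longleftrightarrow>
     subgroup G (BijGroup \<Omega>) \<and> closedin (pointwise_topology \<Omega>) G"

definition perm_group :: "'w set \<Rightarrow> ('w \<Rightarrow> 'w) set \<Rightarrow> ('w \<Rightarrow> 'w) monoid" where
  "perm_group \<Omega> G = BijGroup \<Omega> \<lparr>carrier := G\<rparr>"

definition pointwise_stabilizer :: "('w \<Rightarrow> 'w) set \<Rightarrow> 'w set \<Rightarrow> ('w \<Rightarrow> 'w) set" where
  "pointwise_stabilizer G A = {g \<in> G. \<forall>a\<in>A. g a = a}"

definition no_algebraicity :: "'w set \<Rightarrow> ('w \<Rightarrow> 'w) set \<Rightarrow> bool" where
  "no_algebraicity \<Omega> G \<longleftrightarrow>
     (\<forall>A. finite A \<and> A \<subseteq> \<Omega> \<longrightarrow>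
       (\<forall>\<omega>\<in>\<Omega> - A. infinite (orbit (perm_group \<Omega> (pointwise_stabilizer G A)) (\<lambda>g. g) \<omega>)))"


section \<open>Standard Borel spaces\<close>

text \<open>
  A measurable space is represented by a value of type \<^typ>\<open>'z measure\<close> of which only
  \<^const>\<open>space\<close> and \<^const>\<open>sets\<close> are used.
\<close>

definition standard_borel :: "'z measure \<Rightarrow> bool" where
  "standard_borel Z \<longleftrightarrow>
     (\<exists>T. topspace T = space Z \<and> completely_metrizable_space T \<and> separable_space T \<and>
          sets Z = sigma_sets (space Z) {U. openin T U})"


section \<open>Invariant measures on a power space\<close>

definition coord_action :: "'w set \<Rightarrow> ('w \<Rightarrow> 'w) \<Rightarrow> ('w \<Rightarrow> 'z) \<Rightarrow> ('w \<Rightarrow> 'z)" where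
  "coord_action \<Omega> g z = (\<lambda>\<omega>\<in>\<Omega>. z (inv_into \<Omega> g \<omega>))"

definition action_invariant :: "'w set \<Rightarrow> ('w \<Rightarrow> 'w) set \<Rightarrow> ('w \<Rightarrow> 'z) measure \<Rightarrow> bool" where
  "action_invariant \<Omega> G \<mu> \<longleftrightarrow> (\<forall>g\<in>G. distr \<mu> \<mu> (coord_action \<Omega> g) = \<mu>)"

definition fixed_sets ::
    "'w set \<Rightarrow> ('w \<Rightarrow> 'w) set \<Rightarrow> ('w \<Rightarrow> 'z) measure \<Rightarrow> 'w set \<Rightarrow> ('w \<Rightarrow> 'z) set set" where
  "fixed_sets \<Omega> G \<mu> A =
     {Y \<in> sets \<mu>. \<forall>g\<in>pointwise_stabilizer G A. measure \<mu> (sym_diff (coord_action \<Omega> g ` Y) Y) = 0}"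

text \<open>
  For a probability measure \<open>\<mu>\<close> on the power space and a subgroup \<open>G\<close> the family \<^const>\<open>fixed_sets\<close> is itself a \<open>\<sigma>\<close>-algebra, so that
  \<^const>\<open>sigma\<close> below adds no further sets; see \<open>sets_fixed_algebra\<close>.
\<close>

definition fixed_algebra ::
    "'w set \<Rightarrow> ('w \<Rightarrow> 'w) set \<Rightarrow> ('w \<Rightarrow> 'z) measure \<Rightarrow> 'w set \<Rightarrow> ('w \<Rightarrow> 'z) measure" where
  "fixed_algebra \<Omega> G \<mu> A = sigma (space \<mu>) (fixed_sets \<Omega> G \<mu> A)"

definition ergodic_measure :: "'w set \<Rightarrow> ('w \<Rightarrow> 'w) set \<Rightarrow> ('w \<Rightarrow> 'z) measure \<Rightarrow> bool" where
  "ergodic_measure \<Omega> G \<mu> \<longleftrightarrow> (\<forall>Y\<in>fixed_sets \<Omega> G \<mu> {}. measure \<mu> Y \<in> {0, 1})"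

definition dissociated :: "'w set \<Rightarrow> ('w \<Rightarrow> 'w) set \<Rightarrow> ('w \<Rightarrow> 'z) measure \<Rightarrow> bool" where
  "dissociated \<Omega> G \<mu> \<longleftrightarrow>
     (\<forall>A B. finite A \<and> A \<subseteq> \<Omega> \<and> finite B \<and> B \<subseteq> \<Omega> \<longrightarrow>
       (\<forall>f :: ('w \<Rightarrow> 'z) \<Rightarrow> real.
          f \<in> borel_measurable (fixed_algebra \<Omega> G \<mu> B) \<and> integrable \<mu> (\<lambda>x. (f x)\<^sup>2) \<longrightarrow>
          (AE x in \<mu>. real_cond_exp \<mu> (fixed_algebra \<Omega> G \<mu> A) f x =
                      real_cond_exp \<mu> (fixed_algebra \<Omega> G \<mu> (A \<inter> B)) f x)))"


section \<open>The fixed sets form a sub-\<open>\<sigma>\<close>-algebra\<close>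

lemma coord_action_measurable:
  assumes "g \<in> Bij \<Omega>"
  shows "coord_action \<Omega> g \<in> measurable (Pi\<^sub>M \<Omega> (\<lambda>_. Z)) (Pi\<^sub>M \<Omega> (\<lambda>_. Z))"
  unfolding coord_action_def
  by (rule measurable_restrict) (auto intro!: measurable_component_singleton Bij_inv_into_mem assms)

lemma coord_action_image:
  assumes g: "g \<in> Bij \<Omega>" and Y: "Y \<subseteq> PiE \<Omega> (\<lambda>_. S)"
  shows "coord_action \<Omega> g ` Y = coord_action \<Omega> (restrict (inv_into \<Omega> g) \<Omega>) -` Y \<inter> PiE \<Omega> (\<lambda>_. S)"
proof -
  let ?h = "restrict (inv_into \<Omega> g) \<Omega>"
  have bij: "bij_betw g \<Omega> \<Omega>" using g by (simp add: Bij_def)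
  have h: "?h \<in> Bij \<Omega>" by (rule restrict_inv_into_Bij[OF g])
  have hg: "inv_into \<Omega> ?h w = g w" if "w \<in> \<Omega>" for w
  proof -
    have "inj_on ?h \<Omega>" using h by (simp add: Bij_def bij_betw_def)
    moreover have "g w \<in> \<Omega>" "?h (g w) = w"
      using that bij by (auto simp: bij_betw_def inv_into_f_f)
    ultimately show ?thesis by (metis inv_into_f_f)
  qed
  have gin: "g w \<in> \<Omega>" "inv_into \<Omega> g w \<in> \<Omega>" "inv_into \<Omega> g (g w) = w" "g (inv_into \<Omega> g w) = w"
    if "w \<in> \<Omega>" for w
    using that bij by (auto simp: bij_betw_def inv_into_f_f f_inv_into_f inv_into_into)
  have 1: "coord_action \<Omega> ?h (coord_action \<Omega> g z) = z" if "z \<in> PiE \<Omega> (\<lambda>_. S)" for z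
  proof
    fix w show "coord_action \<Omega> ?h (coord_action \<Omega> g z) w = z w"
      using gin[of w] hg[of w] PiE_arb[OF that, of w]
      by (cases "w \<in> \<Omega>") (simp_all add: coord_action_def)
  qed
  have 2: "coord_action \<Omega> g (coord_action \<Omega> ?h z) = z" if "z \<in> PiE \<Omega> (\<lambda>_. S)" for z
  proof
    fix w show "coord_action \<Omega> g (coord_action \<Omega> ?h z) w = z w"
      using gin[of w] hg[of "inv_into \<Omega> g w"] PiE_arb[OF that, of w]
      by (cases "w \<in> \<Omega>") (simp_all add: coord_action_def)
  qed
  have 3: "coord_action \<Omega> g z \<in> PiE \<Omega> (\<lambda>_. S)" if "z \<in> PiE \<Omega> (\<lambda>_. S)" for z
    unfolding coord_action_def by (simp add: PiE_mem[OF that] gin(2))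
  show ?thesis
  proof (intro equalityI subsetI)
    fix z assume "z \<in> coord_action \<Omega> g ` Y"
    then obtain y where "y \<in> Y" "z = coord_action \<Omega> g y" by blast
    moreover have "y \<in> PiE \<Omega> (\<lambda>_. S)" using Y \<open>y \<in> Y\<close> by blast
    ultimately show "z \<in> coord_action \<Omega> ?h -` Y \<inter> PiE \<Omega> (\<lambda>_. S)"
      using 1[of y] 3[of y] by simp
  next
    fix z assume "z \<in> coord_action \<Omega> ?h -` Y \<inter> PiE \<Omega> (\<lambda>_. S)"
    then show "z \<in> coord_action \<Omega> g ` Y" using 2[of z] by (intro image_eqI[of _ _ "coord_action \<Omega> ?h z"]) auto
  qed
qed

lemma sets_coord_action_image:
  assumes g: "g \<in> Bij \<Omega>" and mu: "sets \<mu> = sets (Pi\<^sub>M \<Omega> (\<lambda>_. Z))" and Y: "Y \<in> sets \<mu>"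
  shows "coord_action \<Omega> g ` Y \<in> sets \<mu>"
proof -
  have sp: "space (Pi\<^sub>M \<Omega> (\<lambda>_. Z)) = PiE \<Omega> (\<lambda>_. space Z)" by (rule space_PiM)
  have "Y \<subseteq> PiE \<Omega> (\<lambda>_. space Z)" using Y mu sets.sets_into_space sp by blast
  then show ?thesis
    using measurable_sets[OF coord_action_measurable[OF restrict_inv_into_Bij[OF g], where Z = Z]] Y
    unfolding coord_action_image[OF g \<open>Y \<subseteq> _\<close>] mu sp by blast
qed

lemma sigma_algebra_fixed_sets:
  assumes G: "subgroup G (BijGroup \<Omega>)" and mu: "sets \<mu> = sets (Pi\<^sub>M \<Omega> (\<lambda>_. Z))"
    and "prob_space \<mu>"
  shows "sigma_algebra (space \<mu>) (fixed_sets \<Omega> G \<mu> A)"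
proof -
  interpret prob_space \<mu> by fact
  have sp: "space \<mu> = PiE \<Omega> (\<lambda>_. space Z)"
    using sets_eq_imp_space_eq[OF mu] by (simp add: space_PiM)
  have Bij: "g \<in> Bij \<Omega>" if "g \<in> pointwise_stabilizer G A" for g
    using that subgroup.subset[OF G] by (auto simp: pointwise_stabilizer_def BijGroup_def)
  have vimage: "sym_diff (f -` (X - Y) \<inter> X) (X - Y) = sym_diff (f -` Y \<inter> X) Y"
    if "\<And>z. z \<in> X \<Longrightarrow> f z \<in> X" "Y \<subseteq> X" for f :: "('a \<Rightarrow> 'b) \<Rightarrow> ('a \<Rightarrow> 'b)" and X Y
    using that by auto
  let ?n = "\<lambda>g Y. sym_diff (coord_action \<Omega> g ` Y) Y"
  have iff: "Y \<in> fixed_sets \<Omega> G \<mu> A \<longleftrightarrow>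
      Y \<in> sets \<mu> \<and> (\<forall>g\<in>pointwise_stabilizer G A. ?n g Y \<in> null_sets \<mu>)" for Y
    using sets_coord_action_image[OF Bij mu, of _ Y]
    by (auto simp: fixed_sets_def null_sets_def emeasure_eq_measure)
  have compl: "?n g (space \<mu> - Y) = ?n g Y"
    if Y: "Y \<in> sets \<mu>" and g: "g \<in> pointwise_stabilizer G A" for Y g
  proof -
    have s: "Y \<subseteq> PiE \<Omega> (\<lambda>_. space Z)" using Y sets.sets_into_space sp by blast
    have h: "coord_action \<Omega> (restrict (inv_into \<Omega> g) \<Omega>) z \<in> PiE \<Omega> (\<lambda>_. space Z)"
      if "z \<in> PiE \<Omega> (\<lambda>_. space Z)" for z
      using measurable_space[OF coord_action_measurable[OF restrict_inv_into_Bij[OF Bij[OF g]], where Z = Z]] that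
      by (simp add: space_PiM)
    show ?thesis
      unfolding sp coord_action_image[OF Bij[OF g] s] coord_action_image[OF Bij[OF g] Diff_subset]
      by (rule vimage[OF h s])
  qed
  show ?thesis
    unfolding sigma_algebra_iff2
  proof (intro conjI ballI allI impI)
    show "fixed_sets \<Omega> G \<mu> A \<subseteq> Pow (space \<mu>)"
      using sets.sets_into_space by (auto simp: fixed_sets_def)
    show "{} \<in> fixed_sets \<Omega> G \<mu> A" by (simp add: fixed_sets_def)
    show "space \<mu> - Y \<in> fixed_sets \<Omega> G \<mu> A" if "Y \<in> fixed_sets \<Omega> G \<mu> A" for Y
      using that compl[of Y] unfolding iff by auto
    show "(\<Union>i. Y i) \<in> fixed_sets \<Omega> G \<mu> A"
      if "range Y \<subseteq> fixed_sets \<Omega> G \<mu> A" for Y :: "nat \<Rightarrow> _"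
      unfolding iff
    proof (intro conjI ballI)
      have Y: "Y i \<in> sets \<mu>" for i using that by (auto simp: fixed_sets_def)
      then show U: "(\<Union>i. Y i) \<in> sets \<mu>" by auto
      fix g assume g: "g \<in> pointwise_stabilizer G A"
      have "?n g (Y i) \<in> null_sets \<mu>" for i
        using that iff[of "Y i"] g by auto
      then have "(\<Union>i. ?n g (Y i)) \<in> null_sets \<mu>" by auto
      moreover have "?n g (\<Union>i. Y i) \<subseteq> (\<Union>i. ?n g (Y i))" by blast
      moreover have "?n g (\<Union>i. Y i) \<in> sets \<mu>"
        using sets_coord_action_image[OF Bij[OF g] mu U] U by auto
      ultimately show "?n g (\<Union>i. Y i) \<in> null_sets \<mu>"
        using null_sets_subset by blast
    qed
  qed
qed

lemma sets_fixed_algebra: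
  assumes "subgroup G (BijGroup \<Omega>)" "sets \<mu> = sets (Pi\<^sub>M \<Omega> (\<lambda>_. Z))" "prob_space \<mu>"
  shows "sets (fixed_algebra \<Omega> G \<mu> A) = fixed_sets \<Omega> G \<mu> A"
  using sigma_algebra.sets_measure_of_eq[OF sigma_algebra_fixed_sets[OF assms]]
  by (simp add: fixed_algebra_def)

lemma subalgebra_fixed_algebra:
  assumes "subgroup G (BijGroup \<Omega>)" "sets \<mu> = sets (Pi\<^sub>M \<Omega> (\<lambda>_. Z))" "prob_space \<mu>"
  shows "subalgebra \<mu> (fixed_algebra \<Omega> G \<mu> A)"
proof -
  have "fixed_sets \<Omega> G \<mu> A \<subseteq> sets \<mu>" by (auto simp: fixed_sets_def)
  moreover have "space (fixed_algebra \<Omega> G \<mu> A) = space \<mu>"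
    using sets.sets_into_space by (auto simp: fixed_algebra_def fixed_sets_def intro!: space_measure_of)
  ultimately show ?thesis by (simp add: subalgebra_def sets_fixed_algebra[OF assms])
qed

end

theory Submission
  imports Defs
begin

text \<open>
  \<^emph>\<open>Dissociated implies product.\<close>  An event that depends only on the coordinates in a finite set \<open>A\<close>
  is fixed by every permutation that fixes \<open>A\<close> pointwise, so it belongs to \<open>\<F>\<^sub>A\<close>.  If \<open>A\<close> and \<open>B\<close> are
  disjoint, dissociation makes \<open>\<F>\<^sub>A\<close> and \<open>\<F>\<^sub>B\<close> conditionally independent over \<open>\<F>\<^sub>\<emptyset>\<close>, and ergodicity
  says that \<open>\<F>\<^sub>\<emptyset>\<close> is trivial; hence \<open>\<F>\<^sub>A\<close> and \<open>\<F>\<^sub>B\<close> are independent (\<open>dissociated_independent\<close>).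
  Splitting off one coordinate at a time shows that the coordinates are independent, and
  transitivity makes them identically distributed.

  \<^emph>\<open>Product implies dissociated.\<close>  Let \<open>P\<close> be the product measure.  The point is that
  up to null sets \<open>\<F>\<^sub>A\<close> contains nothing but events that depend on the coordinates in \<open>A\<close>.  This is
  phrased by resampling: let \<open>x\<close> and \<open>y\<close> be independent with law \<open>P\<close>, and let \<open>x'\<close> agree with \<open>x\<close> on \<open>A\<close>
  and with \<open>y\<close> elsewhere.  Then \<open>x \<in> Y \<longleftrightarrow> x' \<in> Y\<close> almost surely for every \<open>Y\<close> in \<open>\<F>\<^sub>A\<close>
  (\<open>fixed_set_determined\<close>).  To see this, replace \<open>Y\<close> up to \<open>\<epsilon>\<close> by an event \<open>C\<close> on finitely many
  coordinates \<open>D\<close>.  No algebraicity provides a \<open>g\<close> that fixes \<open>A\<close> pointwise and moves \<open>D - A\<close> off \<open>D\<close>;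
  for a \<open>P\<close>-random \<open>z\<close>, the pair of restrictions to \<open>D\<close> of \<open>z\<close> and \<open>z \<circ> g\<close> then has the same law as that of
  \<open>x\<close> and \<open>x'\<close>.  Since \<open>g\<close> preserves \<open>Y\<close> up to a null set, it preserves \<open>C\<close> up to a set of measure
  \<open>2\<epsilon>\<close>, and so \<open>x \<in> Y\<close> and \<open>x' \<in> Y\<close> differ with probability below \<open>4\<epsilon>\<close>.

  Consequently an \<open>\<F>\<^sub>B\<close>-measurable \<open>f\<close> may be assumed to depend on the coordinates in \<open>B\<close> only.  Its
  conditional expectation given \<open>\<F>\<^sub>A\<close> is obtained by integrating out the coordinates outside
  \<open>A \<inter> B\<close> (\<open>real_cond_exp_fixed_algebra\<close>), a formula that gives the same result for \<open>A\<close> and for \<open>A \<inter> B\<close>.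
\<close>

section \<open>Permutations without algebraicity\<close>

lemma pointwise_stabilizer_Bij:
  assumes "subgroup G (BijGroup \<Omega>)" "g \<in> pointwise_stabilizer G A"
  shows "g \<in> G" "g \<in> Bij \<Omega>"
  using assms subgroup.subset[OF assms(1)] by (auto simp: pointwise_stabilizer_def BijGroup_def)

lemma Bij_mem: "g \<in> Bij \<Omega> \<Longrightarrow> \<omega> \<in> \<Omega> \<Longrightarrow> g \<omega> \<in> \<Omega>"
  by (auto simp: Bij_def bij_betw_def)

lemma compose_in_subgroup:
  assumes "subgroup G (BijGroup \<Omega>)" "g \<in> G" "h \<in> G"
  shows "compose \<Omega> h g \<in> G"
proof -
  have "g \<in> Bij \<Omega>" "h \<in> Bij \<Omega>"
    using assms subgroup.subset[OF assms(1)] by (auto simp: BijGroup_def)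
  then show ?thesis
    using subgroup.m_closed[OF assms(1) assms(3,2)] by (simp add: BijGroup_def)
qed

lemma restrict_inv_in_subgroup:
  assumes "subgroup G (BijGroup \<Omega>)" "g \<in> G"
  shows "restrict (inv_into \<Omega> g) \<Omega> \<in> G"
proof -
  have "g \<in> Bij \<Omega>"
    using assms subgroup.subset[OF assms(1)] by (auto simp: BijGroup_def)
  then show ?thesis
    using subgroup.m_inv_closed[OF assms] by (simp add: inv_BijGroup)
qed

text \<open>
  The points of \<open>E\<close> are moved out of \<open>D\<close> one after the other.  Once \<open>g\<close> has displaced \<open>E\<close>, the next point \<open>e\<close>
  is sent by \<open>g\<close> to some point outside \<open>A \<union> g ` E\<close>; its orbit under the stabilizer of this finite
  set is infinite, so some \<open>h\<close> in that stabilizer takes it out of \<open>D\<close> without touching what has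
  been achieved.
\<close>

lemma no_algebraicity_displaces:
  assumes G: "subgroup G (BijGroup \<Omega>)" and na: "no_algebraicity \<Omega> G"
    and A: "finite A" "A \<subseteq> \<Omega>" and D: "finite D"
    and E: "finite E" "E \<subseteq> \<Omega> - A"
  shows "\<exists>g\<in>pointwise_stabilizer G A. g ` E \<inter> D = {}"
  using E
proof (induction E rule: finite_induct)
  case empty
  have "(\<lambda>\<omega>\<in>\<Omega>. \<omega>) \<in> pointwise_stabilizer G A"
    using subgroup.one_closed[OF G] A by (auto simp: pointwise_stabilizer_def BijGroup_def)
  then show ?case by blast
next
  case (insert e E)
  then obtain g where g: "g \<in> pointwise_stabilizer G A" and gE: "g ` E \<inter> D = {}" by auto
  note gB = pointwise_stabilizer_Bij[OF G g]
  have inj: "inj_on g \<Omega>" using gB by (simp add: Bij_def bij_betw_def)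
  let ?A = "A \<union> g ` E"
  have fin: "finite ?A" and sub: "?A \<subseteq> \<Omega>"
    using A insert Bij_mem[OF gB(2)] by auto
  have "g e \<notin> A"
  proof
    assume a: "g e \<in> A"
    then have "g (g e) = g e" using g by (simp add: pointwise_stabilizer_def)
    then have "g e = e" using inj a A insert.prems by (auto dest: inj_onD)
    then show False using a insert.prems by auto
  qed
  moreover have "g e \<notin> g ` E"
    using inj insert by (auto dest: inj_onD)
  ultimately have "g e \<in> \<Omega> - ?A" using insert.prems Bij_mem[OF gB(2)] by auto
  then have "infinite (orbit (perm_group \<Omega> (pointwise_stabilizer G ?A)) (\<lambda>g. g) (g e))"
    using na fin sub unfolding no_algebraicity_def by blast
  then obtain w where "w \<in> orbit (perm_group \<Omega> (pointwise_stabilizer G ?A)) (\<lambda>g. g) (g e)" "w \<notin> D"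
    using D by (meson finite_subset subsetI)
  then obtain h where h: "h \<in> pointwise_stabilizer G ?A" and he: "h (g e) \<notin> D"
    by (auto simp: orbit_def perm_group_def)
  let ?k = "compose \<Omega> h g"
  have "?k \<in> pointwise_stabilizer G A"
    using compose_in_subgroup[OF G gB(1) pointwise_stabilizer_Bij(1)[OF G h]] g h A
    by (auto simp: pointwise_stabilizer_def compose_def)
  moreover have "?k ` insert e E \<inter> D = {}"
    using insert.prems he gE h by (auto simp: compose_def pointwise_stabilizer_def)
  ultimately show ?case by blast
qed

section \<open>The action on sets\<close>

lemma coord_action_inverse_eq_compose:
  assumes "g \<in> Bij \<Omega>"
  shows "coord_action \<Omega> (restrict (inv_into \<Omega> g) \<Omega>) z = compose \<Omega> z g"
proof -
  have "inv_into \<Omega> (restrict (inv_into \<Omega> g) \<Omega>) \<omega> = g \<omega>" if "\<omega> \<in> \<Omega>" for \<omega>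
  proof -
    have "inj_on (restrict (inv_into \<Omega> g) \<Omega>) \<Omega>"
      using restrict_inv_into_Bij[OF assms] by (simp add: Bij_def bij_betw_def)
    moreover have "g \<omega> \<in> \<Omega>" "restrict (inv_into \<Omega> g) \<Omega> (g \<omega>) = \<omega>"
      using that assms by (auto simp: Bij_def bij_betw_def inv_into_f_f)
    ultimately show ?thesis by (metis inv_into_f_f)
  qed
  then show ?thesis by (auto simp: coord_action_def compose_def)
qed

text \<open>
  Membership in a translate becomes a condition on \<open>z \<circ> g\<close>, so that no inverse of \<open>g\<close> has to be
  handled when translates are compared coordinate by coordinate.
\<close>

lemma coord_action_image_eq_compose:
  assumes g: "g \<in> Bij \<Omega>" and Y: "Y \<subseteq> PiE \<Omega> (\<lambda>_. S)"
  shows "coord_action \<Omega> g ` Y = {z \<in> PiE \<Omega> (\<lambda>_. S). compose \<Omega> z g \<in> Y}"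
  unfolding coord_action_image[OF assms] coord_action_inverse_eq_compose[OF g, abs_def] by auto

text \<open>
  The dependence is required on an ambient set \<open>X\<close> only, because the extensional functions that form
  a product space are a proper subset of their type.  Events are treated as boolean-valued functions.
\<close>

definition depends_only_on :: "('w \<Rightarrow> 'z) set \<Rightarrow> 'w set \<Rightarrow> (('w \<Rightarrow> 'z) \<Rightarrow> 'b) \<Rightarrow> bool" where
  "depends_only_on X A f \<longleftrightarrow> (\<forall>x\<in>X. \<forall>y\<in>X. (\<forall>a\<in>A. x a = y a) \<longrightarrow> f x = f y)"

lemma depends_only_on_in_fixed_sets:
  assumes G: "subgroup G (BijGroup \<Omega>)" and mu: "sets \<mu> = sets (Pi\<^sub>M \<Omega> (\<lambda>_. Z))"
    and A: "A \<subseteq> \<Omega>" and Y: "Y \<in> sets \<mu>" and dep: "depends_only_on (space \<mu>) A (\<lambda>x. x \<in> Y)"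
  shows "Y \<in> fixed_sets \<Omega> G \<mu> A"
proof -
  have sp: "space \<mu> = PiE \<Omega> (\<lambda>_. space Z)"
    using sets_eq_imp_space_eq[OF mu] by (simp add: space_PiM)
  have sub: "Y \<subseteq> PiE \<Omega> (\<lambda>_. space Z)" using Y sets.sets_into_space sp by blast
  have "coord_action \<Omega> g ` Y = Y" if g: "g \<in> pointwise_stabilizer G A" for g
  proof -
    note gB = pointwise_stabilizer_Bij(2)[OF G g]
    have "compose \<Omega> z g \<in> Y \<longleftrightarrow> z \<in> Y" if z: "z \<in> space \<mu>" for z
    proof -
      have "compose \<Omega> z g \<in> space \<mu>"
        using z Bij_mem[OF gB] unfolding sp by (auto simp: compose_def PiE_iff)
      moreover have "\<forall>a\<in>A. compose \<Omega> z g a = z a"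
        using g A by (auto simp: compose_def pointwise_stabilizer_def)
      ultimately show ?thesis using dep z unfolding depends_only_on_def by blast
    qed
    then show ?thesis unfolding coord_action_image_eq_compose[OF gB sub] using sp sub by auto
  qed
  then show ?thesis using Y by (simp add: fixed_sets_def)
qed

section \<open>Approximation by finitely many coordinates\<close>

text \<open>
  The approximable sets form a \<open>\<sigma>\<close>-algebra that contains the cylinders: a countable union
  is approximated by approximating sufficiently many of its members.
\<close>

lemma finite_coordinates_approximation:
  assumes "finite_measure \<mu>" and mu: "sets \<mu> = sets (Pi\<^sub>M \<Omega> M)"
    and Y: "Y \<in> sets \<mu>" and \<epsilon>: "(\<epsilon>::real) > 0"
  obtains C D where "C \<in> sets \<mu>" "finite D" "D \<subseteq> \<Omega>"
    "depends_only_on (space \<mu>) D (\<lambda>x. x \<in> C)" "measure \<mu> (sym_diff Y C) < \<epsilon>"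
proof -
  interpret finite_measure \<mu> by fact
  have sp: "space \<mu> = space (Pi\<^sub>M \<Omega> M)" using sets_eq_imp_space_eq[OF mu] .
  define appr where "appr Y \<longleftrightarrow> (\<forall>e>0. \<exists>C D. C \<in> sets \<mu> \<and> finite D \<and> D \<subseteq> \<Omega> \<and>
    depends_only_on (space \<mu>) D (\<lambda>x. x \<in> C) \<and> measure \<mu> (sym_diff Y C) < e)" for Y
  have "Y \<in> sigma_sets (space \<mu>) (prod_algebra \<Omega> M)"
    using Y unfolding mu sets_PiM sp space_PiM .
  then have "Y \<in> sets \<mu> \<and> appr Y"
  proof induction
    case (Basic a)
    then have "a \<in> sets \<mu>" unfolding mu sets_PiM by blast
    moreover obtain J E where "a = prod_emb \<Omega> M J (Pi\<^sub>E J E)" "finite J" "J \<subseteq> \<Omega>"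
      by (rule prod_algebraE[OF Basic]) blast
    moreover from this have "depends_only_on (space \<mu>) J (\<lambda>x. x \<in> a)"
      unfolding depends_only_on_def sp by (auto simp: prod_emb_def space_PiM PiE_iff)
    ultimately show ?case unfolding appr_def
      by (intro conjI allI impI exI[of _ a] exI[of _ J]) auto
  next
    case Empty
    then show ?case unfolding appr_def
      by (auto intro!: exI[of _ "{}"] simp: depends_only_on_def)
  next
    case (Compl a)
    show ?case unfolding appr_def
    proof (intro conjI allI impI)
      show "space \<mu> - a \<in> sets \<mu>" using Compl by auto
      fix e :: real assume "e > 0"
      then obtain C D where C: "C \<in> sets \<mu>" "finite D" "D \<subseteq> \<Omega>"
        "depends_only_on (space \<mu>) D (\<lambda>x. x \<in> C)" "measure \<mu> (sym_diff a C) < e"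
        using Compl unfolding appr_def by blast
      moreover have "sym_diff (space \<mu> - a) (space \<mu> - C) = sym_diff a C"
        using Compl C(1) sets.sets_into_space by blast
      moreover have "depends_only_on (space \<mu>) D (\<lambda>x. x \<in> space \<mu> - C)"
        using C(4) unfolding depends_only_on_def by blast
      ultimately show "\<exists>C D. C \<in> sets \<mu> \<and> finite D \<and> D \<subseteq> \<Omega> \<and>
        depends_only_on (space \<mu>) D (\<lambda>x. x \<in> C) \<and> measure \<mu> (sym_diff (space \<mu> - a) C) < e"
        by (intro exI[of _ "space \<mu> - C"] exI[of _ D]) auto
    qed
  next
    case (Union a)
    have [measurable]: "a i \<in> sets \<mu>" for i using Union by blast
    show ?case unfolding appr_def
    proof (intro conjI allI impI)
      show "\<Union> (range a) \<in> sets \<mu>" by auto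
      fix e :: real assume e: "e > 0"
      let ?U = "\<lambda>n. \<Union>i<n. a i"
      have "(\<lambda>n. measure \<mu> (?U n)) \<longlonglongrightarrow> measure \<mu> (\<Union>n. ?U n)"
        by (rule finite_Lim_measure_incseq) (auto simp: incseq_def intro: less_le_trans)
      moreover have U: "(\<Union>n. ?U n) = \<Union> (range a)" by auto
      ultimately have "\<forall>\<^sub>F n in sequentially. measure \<mu> (\<Union> (range a)) - e / 2 < measure \<mu> (?U n)"
        using e by (intro order_tendstoD(1)) auto
      then obtain n where n: "measure \<mu> (\<Union> (range a)) - e / 2 < measure \<mu> (?U n)"
        by (auto simp: eventually_sequentially)
      have tail: "measure \<mu> (\<Union> (range a) - ?U n) < e / 2"
        using n by (subst finite_measure_Diff) auto
      \<comment> \<open>The tail of the union uses up half of the error; the other half is shared by \<open>n\<close> sets, where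
        \<open>n + 1\<close> in the denominator covers the case \<open>n = 0\<close>.\<close>
      define d where "d = e / (2 * (real n + 1))"
      have d: "d > 0" using e by (simp add: d_def)
      then have "\<forall>i. \<exists>C D. C \<in> sets \<mu> \<and> finite D \<and> D \<subseteq> \<Omega> \<and>
        depends_only_on (space \<mu>) D (\<lambda>x. x \<in> C) \<and> measure \<mu> (sym_diff (a i) C) < d"
        using Union unfolding appr_def by blast
      then obtain C D where CD: "\<And>i. C i \<in> sets \<mu>" "\<And>i. finite (D i)" "\<And>i. D i \<subseteq> \<Omega>"
        "\<And>i. depends_only_on (space \<mu>) (D i) (\<lambda>x. x \<in> C i)"
        "\<And>i. measure \<mu> (sym_diff (a i) (C i)) < d"
        by metis
      note [measurable] = CD(1)
      have "measure \<mu> (sym_diff (\<Union> (range a)) (\<Union>i<n. C i)) \<le>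
          measure \<mu> ((\<Union> (range a) - ?U n) \<union> (\<Union>i<n. sym_diff (a i) (C i)))"
        by (rule finite_measure_mono) auto
      also have "\<dots> \<le> measure \<mu> (\<Union> (range a) - ?U n) + measure \<mu> (\<Union>i<n. sym_diff (a i) (C i))"
        by (rule measure_Un_le) auto
      also have "measure \<mu> (\<Union>i<n. sym_diff (a i) (C i)) \<le> (\<Sum>i<n. measure \<mu> (sym_diff (a i) (C i)))"
        by (rule finite_measure_subadditive_finite) auto
      also have "\<dots> \<le> (\<Sum>i<n. d)" using CD(5) by (intro sum_mono less_imp_le) auto
      also have "\<dots> \<le> e / 2" using e by (simp add: d_def field_simps)
      finally have "measure \<mu> (sym_diff (\<Union> (range a)) (\<Union>i<n. C i)) < e" using tail by simp
      moreover have "depends_only_on (space \<mu>) (\<Union>i<n. D i) (\<lambda>x. x \<in> (\<Union>i<n. C i))"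
        unfolding depends_only_on_def
      proof (intro ballI impI)
        fix x y assume xy: "x \<in> space \<mu>" "y \<in> space \<mu>" and eq: "\<forall>j\<in>(\<Union>i<n. D i). x j = y j"
        have "x \<in> C i \<longleftrightarrow> y \<in> C i" if "i < n" for i
          using CD(4)[of i] xy eq that unfolding depends_only_on_def by blast
        then show "x \<in> (\<Union>i<n. C i) \<longleftrightarrow> y \<in> (\<Union>i<n. C i)" by blast
      qed
      ultimately show "\<exists>C D. C \<in> sets \<mu> \<and> finite D \<and> D \<subseteq> \<Omega> \<and>
        depends_only_on (space \<mu>) D (\<lambda>x. x \<in> C) \<and> measure \<mu> (sym_diff (\<Union> (range a)) C) < e"
        using CD(2,3) by (intro exI[of _ "\<Union>i<n. C i"] exI[of _ "\<Union>i<n. D i"]) auto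
    qed
  qed
  then show ?thesis using \<epsilon> that unfolding appr_def by blast
qed

section \<open>Resampling the coordinates of a product measure\<close>

definition resample :: "'w set \<Rightarrow> 'w set \<Rightarrow> ('w \<Rightarrow> 'z) \<Rightarrow> ('w \<Rightarrow> 'z) \<Rightarrow> ('w \<Rightarrow> 'z)" where
  "resample \<Omega> A x y = (\<lambda>\<omega>\<in>\<Omega>. if \<omega> \<in> A then x \<omega> else y \<omega>)"

lemma resample_measurable [measurable]:
  "(\<lambda>(x, y). resample \<Omega> A x y) \<in> Pi\<^sub>M \<Omega> M \<Otimes>\<^sub>M Pi\<^sub>M \<Omega> M \<rightarrow>\<^sub>M Pi\<^sub>M \<Omega> M"
  unfolding resample_def case_prod_beta by measurable

lemma resample_space:
  "x \<in> space (Pi\<^sub>M \<Omega> M) \<Longrightarrow> y \<in> space (Pi\<^sub>M \<Omega> M) \<Longrightarrow> resample \<Omega> A x y \<in> space (Pi\<^sub>M \<Omega> M)"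
  by (auto simp: resample_def space_PiM)

lemma depends_only_on_resample:
  "A \<subseteq> \<Omega> \<Longrightarrow> depends_only_on X A (\<lambda>x. f (resample \<Omega> A x y))"
  unfolding depends_only_on_def resample_def
  by (auto intro!: arg_cong[where f = f] restrict_ext)

locale iid_coordinates = M: prob_space M for M :: "'z measure" +
  fixes \<Omega> :: "'w set"
begin

abbreviation P :: "('w \<Rightarrow> 'z) measure" where "P \<equiv> Pi\<^sub>M \<Omega> (\<lambda>_. M)"

sublocale coord: product_prob_space "\<lambda>_. M" \<Omega>
  by unfold_locales

sublocale pair_prob_space P P
  by unfold_locales

lemma distr_resample: "distr (P \<Otimes>\<^sub>M P) P (\<lambda>(x, y). resample \<Omega> A x y) = P"
proof (rule coord.PiM_eq)
  fix J F assume J: "finite J" "J \<subseteq> \<Omega>" "\<And>j. j \<in> J \<Longrightarrow> F j \<in> sets M"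
  define emb where "emb K = {x \<in> space P. \<forall>j\<in>K. x j \<in> F j}" for K
  have Jemb: "prod_emb \<Omega> (\<lambda>_. M) J (Pi\<^sub>E J F) = emb J"
    using J by (auto simp: emb_def prod_emb_def space_PiM PiE_iff extensional_def)
  have emb: "emeasure P (emb K) = (\<Prod>j\<in>K. emeasure M (F j))" if "K \<subseteq> J" for K
    unfolding emb_def using that J
    by (intro coord.emeasure_PiM_Collect) (auto intro: finite_subset)
  have meas: "emb K \<in> sets P" if "K \<subseteq> J" for K
  proof -
    have [measurable]: "finite K" using that J finite_subset by blast
    have [measurable]: "F j \<in> sets M" "j \<in> \<Omega>" if "j \<in> K" for j using that \<open>K \<subseteq> J\<close> J by auto
    show ?thesis unfolding emb_def by measurable
  qed
  have "resample \<Omega> A x y \<in> emb J \<longleftrightarrow> x \<in> emb (J \<inter> A) \<and> y \<in> emb (J - A)"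
    if xy: "x \<in> space P" "y \<in> space P" for x y
  proof -
    have "resample \<Omega> A x y j = (if j \<in> A then x j else y j)" if "j \<in> J" for j
      using that J by (auto simp: resample_def)
    then have "(\<forall>j\<in>J. resample \<Omega> A x y j \<in> F j) \<longleftrightarrow> (\<forall>j\<in>J \<inter> A. x j \<in> F j) \<and> (\<forall>j\<in>J - A. y j \<in> F j)"
      by auto
    then show ?thesis using xy resample_space[OF xy, of A] by (simp add: emb_def)
  qed
  then have "(\<lambda>(x, y). resample \<Omega> A x y) -` emb J \<inter> space (P \<Otimes>\<^sub>M P) = emb (J \<inter> A) \<times> emb (J - A)"
    by (auto simp: space_pair_measure) (auto simp: emb_def)
  then have "emeasure (distr (P \<Otimes>\<^sub>M P) P (\<lambda>(x, y). resample \<Omega> A x y)) (emb J)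
      = emeasure P (emb (J \<inter> A)) * emeasure P (emb (J - A))"
    by (subst emeasure_distr) (auto simp: meas coord.emeasure_pair_measure_Times)
  also have "\<dots> = (\<Prod>j\<in>J. emeasure M (F j))"
    using prod.Int_Diff[OF J(1), of "\<lambda>j. emeasure M (F j)" A] by (simp add: emb)
  finally show "emeasure (distr (P \<Otimes>\<^sub>M P) P (\<lambda>(x, y). resample \<Omega> A x y))
      (prod_emb \<Omega> (\<lambda>_. M) J (Pi\<^sub>E J F)) = (\<Prod>j\<in>J. emeasure M (F j))"
    unfolding Jemb .
qed simp

lemma distr_compose:
  assumes "inj_on g \<Omega>" "g \<in> \<Omega> \<rightarrow> \<Omega>"
  shows "distr P P (\<lambda>z. compose \<Omega> z g) = P"
  using distr_PiM_reindex[of \<Omega> "\<lambda>_. M" g \<Omega>] assms M.prob_space_axioms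
  by (simp add: compose_def)

lemma compose_measurable:
  "g \<in> \<Omega> \<rightarrow> \<Omega> \<Longrightarrow> (\<lambda>z. compose \<Omega> z g) \<in> P \<rightarrow>\<^sub>M P"
  unfolding compose_def by (rule measurable_restrict) (auto intro: measurable_component_singleton)

text \<open>
  Permuting the fresh sample \<open>y\<close> first is harmless, as its law is invariant; the freedom to choose \<open>h\<close>
  allows coordinates of \<open>y\<close> to be placed where they are wanted.
\<close>

lemma distr_resample_permuted:
  assumes h: "h \<in> Bij \<Omega>"
  shows "distr (P \<Otimes>\<^sub>M P) P (\<lambda>(x, y). resample \<Omega> A x (compose \<Omega> y h)) = P"
proof -
  have hf: "inj_on h \<Omega>" "h \<in> \<Omega> \<rightarrow> \<Omega>" using h by (auto simp: Bij_def bij_betw_def)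
  note [measurable] = compose_measurable[OF hf(2)]
  have "P \<Otimes>\<^sub>M P = distr P P (\<lambda>x. x) \<Otimes>\<^sub>M distr P P (\<lambda>z. compose \<Omega> z h)"
    by (simp add: distr_compose[OF hf] distr_id)
  also have "\<dots> = distr (P \<Otimes>\<^sub>M P) (P \<Otimes>\<^sub>M P) (\<lambda>(x, y). (x, compose \<Omega> y h))"
    by (rule pair_measure_distr)
      (auto simp: distr_compose[OF hf] coord.P.sigma_finite_measure_axioms)
  finally have "P = distr (distr (P \<Otimes>\<^sub>M P) (P \<Otimes>\<^sub>M P) (\<lambda>(x, y). (x, compose \<Omega> y h))) P
      (\<lambda>(x, y). resample \<Omega> A x y)"
    using distr_resample[of A] by simp
  also have "\<dots> = distr (P \<Otimes>\<^sub>M P) P (\<lambda>(x, y). resample \<Omega> A x (compose \<Omega> y h))"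
    by (subst distr_distr) (auto simp: comp_def split_beta')
  finally show ?thesis by simp
qed

text \<open>
  Modulo null sets, the members of \<open>\<F>\<^sub>A\<close> depend on the coordinates in \<open>A\<close> only.  The proof realizes the law of
  \<open>(x, resample \<Omega> A x y)\<close>, restricted to the finite set \<open>D\<close>, as the law of \<open>(z, z \<circ> g)\<close> for a single \<open>P\<close>-random
  point \<open>z\<close>, and then uses that \<open>g\<close> preserves \<open>Y\<close>.
\<close>

lemma fixed_set_determined:
  assumes G: "subgroup G (BijGroup \<Omega>)" and na: "no_algebraicity \<Omega> G"
    and A: "finite A" "A \<subseteq> \<Omega>" and Y: "Y \<in> fixed_sets \<Omega> G P A"
  shows "AE (x, y) in P \<Otimes>\<^sub>M P. x \<in> Y \<longleftrightarrow> resample \<Omega> A x y \<in> Y"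
proof -
  have Ym [measurable]: "Y \<in> sets P" using Y by (simp add: fixed_sets_def)
  define E where "E = {p \<in> space (P \<Otimes>\<^sub>M P). \<not> (fst p \<in> Y \<longleftrightarrow> resample \<Omega> A (fst p) (snd p) \<in> Y)}"
  have res: "(\<lambda>p. resample \<Omega> A (fst p) (snd p)) \<in> P \<Otimes>\<^sub>M P \<rightarrow>\<^sub>M P"
    using resample_measurable[of \<Omega> A "\<lambda>_. M"] by (simp add: case_prod_beta)
  note [measurable] = res
  have Em [measurable]: "E \<in> sets (P \<Otimes>\<^sub>M P)" unfolding E_def by measurable
  have dist_res: "measure (P \<Otimes>\<^sub>M P) {p \<in> space (P \<Otimes>\<^sub>M P). resample \<Omega> A (fst p) (snd p) \<in> S} = measure P S"
    if "S \<in> sets P" for S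
    using measure_distr[OF resample_measurable[of \<Omega> A "\<lambda>_. M"] that] distr_resample[of A]
    by (simp add: vimage_def Int_def case_prod_beta conj_commute)
  have dist_fst: "measure (P \<Otimes>\<^sub>M P) {p \<in> space (P \<Otimes>\<^sub>M P). fst p \<in> S} = measure P S"
    if "S \<in> sets P" for S
  proof -
    have "{p \<in> space (P \<Otimes>\<^sub>M P). fst p \<in> S} = S \<times> space P"
      using that sets.sets_into_space by (auto simp: space_pair_measure)
    then show ?thesis
      using that by (simp add: measure_def coord.emeasure_pair_measure_Times coord.P.emeasure_space_1)
  qed
  have bound: "measure (P \<Otimes>\<^sub>M P) E < 4 * \<epsilon>" if \<epsilon>: "\<epsilon> > 0" for \<epsilon> :: real
  proof -
    obtain C D where C [measurable]: "C \<in> sets P" and D: "finite D" "D \<subseteq> \<Omega>"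
      and dep: "depends_only_on (space P) D (\<lambda>x. x \<in> C)" and close: "measure P (sym_diff Y C) < \<epsilon>"
      using finite_coordinates_approximation[OF coord.P.finite_measure_axioms refl Ym \<epsilon>] by metis
    obtain g where g: "g \<in> pointwise_stabilizer G A" and gD: "g ` (D - A) \<inter> D = {}"
      using no_algebraicity_displaces[OF G na A D(1), of "D - A"] D by auto
    note gB = pointwise_stabilizer_Bij(2)[OF G g]
    have gf: "inj_on g \<Omega>" "g \<in> \<Omega> \<rightarrow> \<Omega>" using gB by (auto simp: Bij_def bij_betw_def)
    note [measurable] = compose_measurable[OF gf(2)]
    let ?h = "restrict (inv_into \<Omega> g) \<Omega>"
    have h: "?h \<in> Bij \<Omega>" by (rule restrict_inv_into_Bij[OF gB])
    then have hf: "?h \<in> \<Omega> \<rightarrow> \<Omega>" by (auto simp: Bij_def bij_betw_def)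
    note [measurable] = compose_measurable[OF hf]
    have comp_measure: "measure P {z \<in> space P. compose \<Omega> z g \<in> S} = measure P S" if "S \<in> sets P" for S
      using measure_distr[OF compose_measurable[OF gf(2)] that] distr_compose[OF gf]
      by (simp add: vimage_def Int_def conj_commute)
    \<comment> \<open>The point \<open>z = \<psi> (x, y)\<close> has law \<open>P\<close>.  It agrees with \<open>x\<close> on \<open>D\<close>, and off \<open>D\<close> it carries at
      \<open>g \<omega>\<close> the value \<open>y \<omega>\<close>.  As \<open>g\<close> fixes \<open>A\<close> and moves \<open>D - A\<close> off \<open>D\<close>, on \<open>D\<close> the point \<open>z \<circ> g\<close> takes
      the values of \<open>x\<close> at \<open>A\<close> and those of \<open>y\<close> elsewhere.\<close>
    define \<psi> where "\<psi> p = resample \<Omega> D (fst p) (compose \<Omega> (snd p) ?h)" for p :: "('w \<Rightarrow> 'z) \<times> ('w \<Rightarrow> 'z)"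
    have \<psi>m [measurable]: "\<psi> \<in> P \<Otimes>\<^sub>M P \<rightarrow>\<^sub>M P"
      using measurable_compose[OF _ resample_measurable[of \<Omega> D "\<lambda>_. M"],
        of "\<lambda>p. (fst p, compose \<Omega> (snd p) ?h)" "P \<Otimes>\<^sub>M P"]
      unfolding \<psi>_def[abs_def] by simp
    have \<psi>d: "distr (P \<Otimes>\<^sub>M P) P \<psi> = P"
      using distr_resample_permuted[OF h, of D] by (simp add: \<psi>_def[abs_def] split_beta')
    define H where "H = {z \<in> space P. \<not> (z \<in> C \<longleftrightarrow> compose \<Omega> z g \<in> C)}"
    have Hm [measurable]: "H \<in> sets P" unfolding H_def by measurable
    have \<psi>_measure: "measure (P \<Otimes>\<^sub>M P) {p \<in> space (P \<Otimes>\<^sub>M P). \<psi> p \<in> H} = measure P H"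
      using measure_distr[OF \<psi>m Hm] \<psi>d by (simp add: vimage_def Int_def conj_commute)
    have key: "fst p \<in> C \<longleftrightarrow> resample \<Omega> A (fst p) (snd p) \<in> C"
      if p: "p \<in> space (P \<Otimes>\<^sub>M P)" "\<psi> p \<notin> H" for p
    proof -
      have xy: "fst p \<in> space P" "snd p \<in> space P" using p by (auto simp: space_pair_measure)
      have z: "\<psi> p \<in> space P" using measurable_space[OF \<psi>m p(1)] .
      have zg: "compose \<Omega> (\<psi> p) g \<in> space P" using measurable_space[OF compose_measurable[OF gf(2)] z] .
      have "\<forall>d\<in>D. \<psi> p d = fst p d" using D by (auto simp: \<psi>_def resample_def)
      then have 1: "\<psi> p \<in> C \<longleftrightarrow> fst p \<in> C" using dep z xy unfolding depends_only_on_def by blast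
      have "compose \<Omega> (\<psi> p) g d = resample \<Omega> A (fst p) (snd p) d" if d: "d \<in> D" for d
      proof (cases "d \<in> A")
        case True
        then show ?thesis using g d D gf by (auto simp: compose_def \<psi>_def resample_def pointwise_stabilizer_def)
      next
        case False
        then have "g d \<notin> D" using gD d by blast
        moreover have "inv_into \<Omega> g (g d) = d" using gf d D by (auto intro: inv_into_f_f)
        moreover have "d \<in> \<Omega>" "g d \<in> \<Omega>" using d D gf by auto
        ultimately show ?thesis using False by (simp add: compose_def \<psi>_def resample_def)
      qed
      then have 2: "compose \<Omega> (\<psi> p) g \<in> C \<longleftrightarrow> resample \<Omega> A (fst p) (snd p) \<in> C"
        using dep zg resample_space[OF xy] unfolding depends_only_on_def by blast
      show ?thesis using 1 2 p z by (auto simp: H_def)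
    qed
    define N where "N = {z \<in> space P. \<not> (z \<in> Y \<longleftrightarrow> compose \<Omega> z g \<in> Y)}"
    have Nm [measurable]: "N \<in> sets P" unfolding N_def by measurable
    have YS: "Y \<subseteq> PiE \<Omega> (\<lambda>_. space M)" using sets.sets_into_space[OF Ym] by (simp add: space_PiM)
    have "sym_diff (coord_action \<Omega> g ` Y) Y = N"
      unfolding coord_action_image_eq_compose[OF gB YS] N_def using YS by (auto simp: space_PiM)
    then have N0: "measure P N = 0" using Y g unfolding fixed_sets_def by auto
    have "measure P H \<le> measure P (sym_diff Y C \<union> (N \<union> {z \<in> space P. compose \<Omega> z g \<in> sym_diff Y C}))"
      by (rule coord.P.finite_measure_mono) (auto simp: H_def N_def)
    also have "\<dots> \<le> measure P (sym_diff Y C) + measure P (N \<union> {z \<in> space P. compose \<Omega> z g \<in> sym_diff Y C})"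
      by (rule measure_Un_le) auto
    also have "measure P (N \<union> {z \<in> space P. compose \<Omega> z g \<in> sym_diff Y C})
        \<le> measure P N + measure P {z \<in> space P. compose \<Omega> z g \<in> sym_diff Y C}"
      by (rule measure_Un_le) auto
    finally have H: "measure P H < 2 * \<epsilon>"
      using close N0 comp_measure[of "sym_diff Y C"] by simp
    let ?E1 = "{p \<in> space (P \<Otimes>\<^sub>M P). fst p \<in> sym_diff Y C}"
    let ?E2 = "{p \<in> space (P \<Otimes>\<^sub>M P). resample \<Omega> A (fst p) (snd p) \<in> sym_diff Y C}"
    let ?E3 = "{p \<in> space (P \<Otimes>\<^sub>M P). \<psi> p \<in> H}"
    have "E \<subseteq> ?E1 \<union> (?E2 \<union> ?E3)"
      using key unfolding E_def by blast
    then have "measure (P \<Otimes>\<^sub>M P) E \<le> measure (P \<Otimes>\<^sub>M P) (?E1 \<union> (?E2 \<union> ?E3))"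
      by (intro finite_measure_mono) auto
    also have "\<dots> \<le> measure (P \<Otimes>\<^sub>M P) ?E1 + measure (P \<Otimes>\<^sub>M P) (?E2 \<union> ?E3)"
      by (rule measure_Un_le) auto
    also have "measure (P \<Otimes>\<^sub>M P) (?E2 \<union> ?E3) \<le> measure (P \<Otimes>\<^sub>M P) ?E2 + measure (P \<Otimes>\<^sub>M P) ?E3"
      by (rule measure_Un_le) auto
    finally show ?thesis
      using close H \<psi>_measure dist_res[of "sym_diff Y C"] dist_fst[of "sym_diff Y C"] by simp
  qed
  have "measure (P \<Otimes>\<^sub>M P) E \<le> 0"
  proof (rule field_le_epsilon)
    fix e :: real assume "0 < e"
    then show "measure (P \<Otimes>\<^sub>M P) E \<le> 0 + e" using bound[of "e / 4"] by simp
  qed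
  then have "measure (P \<Otimes>\<^sub>M P) E = 0" by (simp add: antisym)
  then have "E \<in> null_sets (P \<Otimes>\<^sub>M P)"
    using Em by (simp add: null_sets_def emeasure_eq_measure)
  then show ?thesis
    by (rule AE_I') (auto simp: E_def)
qed

text \<open>
  A real function is recovered from its sublevel sets at the countably many rational levels, so the
  null sets provided by \<open>fixed_set_determined\<close> can be combined.
\<close>

lemma fixed_algebra_measurable_determined:
  fixes f :: "('w \<Rightarrow> 'z) \<Rightarrow> real"
  assumes G: "subgroup G (BijGroup \<Omega>)" and na: "no_algebraicity \<Omega> G"
    and A: "finite A" "A \<subseteq> \<Omega>" and f: "f \<in> borel_measurable (fixed_algebra \<Omega> G P A)"
  shows "AE (x, y) in P \<Otimes>\<^sub>M P. f x = f (resample \<Omega> A x y)"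
proof -
  note sub = subalgebra_fixed_algebra[OF G refl coord.P.prob_space_axioms]
  have sp: "space (fixed_algebra \<Omega> G P A) = space P"
    using sub by (simp add: subalgebra_def)
  have "AE p in P \<Otimes>\<^sub>M P. \<forall>q::rat. f (fst p) < of_rat q \<longleftrightarrow> f (resample \<Omega> A (fst p) (snd p)) < of_rat q"
    unfolding AE_all_countable
  proof
    fix q :: rat
    have "{x \<in> space P. f x < of_rat q} \<in> fixed_sets \<Omega> G P A"
      using f unfolding borel_measurable_iff_less sp sets_fixed_algebra[OF G refl coord.P.prob_space_axioms]
      by blast
    from fixed_set_determined[OF G na A this]
    have "AE p in P \<Otimes>\<^sub>M P. fst p \<in> {x \<in> space P. f x < of_rat q} \<longleftrightarrow>
        resample \<Omega> A (fst p) (snd p) \<in> {x \<in> space P. f x < of_rat q}"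
      by (simp add: case_prod_beta)
    with AE_space show "AE p in P \<Otimes>\<^sub>M P. f (fst p) < of_rat q \<longleftrightarrow> f (resample \<Omega> A (fst p) (snd p)) < of_rat q"
    proof eventually_elim
      case (elim p)
      then have "fst p \<in> space P" "snd p \<in> space P" by (auto simp: space_pair_measure)
      then show ?case using elim resample_space by blast
    qed
  qed
  then show ?thesis
  proof eventually_elim
    case (elim p)
    have "\<not> f (fst p) < f (resample \<Omega> A (fst p) (snd p))"
      using elim of_rat_dense by (metis less_asym)
    moreover have "\<not> f (resample \<Omega> A (fst p) (snd p)) < f (fst p)"
      using elim of_rat_dense by (metis less_asym)
    ultimately show ?case by (simp add: case_prod_beta)
  qed
qed

text \<open>
  By Fubini, almost every \<open>y\<close> satisfies \<open>f x = f (resample \<Omega> A x y)\<close> for almost all \<open>x\<close>; fixing one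
  such \<open>y\<close> turns the right-hand side into a function of the coordinates in \<open>A\<close>.
\<close>

lemma fixed_algebra_representative:
  fixes f :: "('w \<Rightarrow> 'z) \<Rightarrow> real"
  assumes G: "subgroup G (BijGroup \<Omega>)" and na: "no_algebraicity \<Omega> G"
    and A: "finite A" "A \<subseteq> \<Omega>" and f: "f \<in> borel_measurable (fixed_algebra \<Omega> G P A)"
  obtains f' where "f' \<in> borel_measurable P" "depends_only_on (space P) A f'" "AE x in P. f x = f' x"
proof -
  have fP [measurable]: "f \<in> borel_measurable P"
    using measurable_from_subalg[OF subalgebra_fixed_algebra[OF G refl coord.P.prob_space_axioms] f] .
  have res [measurable]: "(\<lambda>p. resample \<Omega> A (fst p) (snd p)) \<in> P \<Otimes>\<^sub>M P \<rightarrow>\<^sub>M P"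
    using resample_measurable[of \<Omega> A "\<lambda>_. M"] by (simp add: case_prod_beta)
  have "AE x in P. AE y in P. f x = f (resample \<Omega> A x y)"
    using AE_pair[OF fixed_algebra_measurable_determined[OF G na A f]] by simp
  moreover have "{p \<in> space (P \<Otimes>\<^sub>M P). f (fst p) = f (resample \<Omega> A (fst p) (snd p))} \<in> sets (P \<Otimes>\<^sub>M P)"
    by measurable
  ultimately have "AE y in P. AE x in P. f x = f (resample \<Omega> A x y)"
    using AE_commute[where P = "\<lambda>x y. f x = f (resample \<Omega> A x y)"] by blast
  with AE_space have "AE y in P. y \<in> space P \<and> (AE x in P. f x = f (resample \<Omega> A x y))"
    by eventually_elim simp
  then obtain y where y: "y \<in> space P" and eq: "AE x in P. f x = f (resample \<Omega> A x y)"
    using eventually_happens'[OF coord.P.ae_filter_bot] by blast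
  have "(\<lambda>x. resample \<Omega> A x y) \<in> P \<rightarrow>\<^sub>M P"
    using measurable_compose[OF measurable_Pair2'[OF y] resample_measurable[of \<Omega> A "\<lambda>_. M"]] by simp
  then have "(\<lambda>x. f (resample \<Omega> A x y)) \<in> borel_measurable P" by measurable
  then show ?thesis using that eq depends_only_on_resample[OF A(2)] by blast
qed

lemma depends_only_on_fixed_algebra_measurable:
  fixes f :: "('w \<Rightarrow> 'z) \<Rightarrow> real"
  assumes G: "subgroup G (BijGroup \<Omega>)" and A: "A \<subseteq> \<Omega>"
    and f [measurable]: "f \<in> borel_measurable P" and dep: "depends_only_on (space P) A f"
  shows "f \<in> borel_measurable (fixed_algebra \<Omega> G P A)"
proof -
  have sp: "space (fixed_algebra \<Omega> G P A) = space P"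
    using subalgebra_fixed_algebra[OF G refl coord.P.prob_space_axioms] by (simp add: subalgebra_def)
  have "{x \<in> space P. f x < a} \<in> fixed_sets \<Omega> G P A" for a
  proof (rule depends_only_on_in_fixed_sets[OF G refl A])
    show "{x \<in> space P. f x < a} \<in> sets P" by measurable
    show "depends_only_on (space P) A (\<lambda>x. x \<in> {x \<in> space P. f x < a})"
      unfolding depends_only_on_def
    proof (intro ballI impI)
      fix x y assume "x \<in> space P" "y \<in> space P" "\<forall>a\<in>A. x a = y a"
      moreover from this have "f x = f y" using dep unfolding depends_only_on_def by blast
      ultimately show "x \<in> {x \<in> space P. f x < a} \<longleftrightarrow> y \<in> {x \<in> space P. f x < a}" by simp
    qed
  qed
  then show ?thesis
    unfolding borel_measurable_iff_less sp sets_fixed_algebra[OF G refl coord.P.prob_space_axioms] by blast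
qed

text \<open>
  The right-hand side depends on the coordinates in \<open>A\<close> only, so it is \<open>\<F>\<^sub>A\<close>-measurable.  For \<open>Y\<close> in \<open>\<F>\<^sub>A\<close> with
  representative \<open>k\<close>, integrate \<open>k * f\<close> along the measure-preserving map \<open>resample \<Omega> A\<close>: there \<open>k\<close> sees
  only \<open>x\<close>, and \<open>f\<close>, which sees only \<open>B\<close>, cannot tell \<open>resample \<Omega> A\<close> from \<open>resample \<Omega> (A \<inter> B)\<close>.
\<close>

lemma real_cond_exp_fixed_algebra:
  fixes f :: "('w \<Rightarrow> 'z) \<Rightarrow> real"
  assumes G: "subgroup G (BijGroup \<Omega>)" and na: "no_algebraicity \<Omega> G"
    and A: "finite A" "A \<subseteq> \<Omega>" and B: "B \<subseteq> \<Omega>"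
    and f: "integrable P f" and dep: "depends_only_on (space P) B f"
  shows "AE x in P. real_cond_exp P (fixed_algebra \<Omega> G P A) f x = (\<integral>y. f (resample \<Omega> (A \<inter> B) x y) \<partial>P)"
proof -
  interpret F: finite_measure_subalgebra P "fixed_algebra \<Omega> G P A"
    by unfold_locales (rule subalgebra_fixed_algebra[OF G refl coord.P.prob_space_axioms])
  have [measurable]: "f \<in> borel_measurable P" using f by auto
  have res [measurable]: "(\<lambda>p. resample \<Omega> K (fst p) (snd p)) \<in> P \<Otimes>\<^sub>M P \<rightarrow>\<^sub>M P" for K
    using resample_measurable[of \<Omega> K "\<lambda>_. M"] by (simp add: case_prod_beta)
  have dres: "distr (P \<Otimes>\<^sub>M P) P (\<lambda>p. resample \<Omega> K (fst p) (snd p)) = P" for K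
    using distr_resample[of K] by (simp add: split_beta')
  define h where "h x = (\<integral>y. f (resample \<Omega> (A \<inter> B) x y) \<partial>P)" for x
  have intres: "integrable (P \<Otimes>\<^sub>M P) (\<lambda>p. u (resample \<Omega> K (fst p) (snd p)))"
    if "integrable P u" for u :: "('w \<Rightarrow> 'z) \<Rightarrow> real" and K
    using integrable_distr[OF res[of K], of u] that dres[of K] by simp
  have hint: "integrable P h"
    using integrable_fst'[OF intres[OF f, of "A \<inter> B"]] unfolding h_def[abs_def] by simp
  then have hm [measurable]: "h \<in> borel_measurable P" by auto
  have "depends_only_on (space P) A h"
    unfolding depends_only_on_def
  proof (intro ballI impI)
    fix x x' :: "'w \<Rightarrow> 'z" assume "\<forall>a\<in>A. x a = x' a"
    then have "resample \<Omega> (A \<inter> B) x y = resample \<Omega> (A \<inter> B) x' y" for y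
      by (auto simp: resample_def intro!: restrict_ext)
    then show "h x = h x'" by (simp add: h_def)
  qed
  then have hF: "h \<in> borel_measurable (fixed_algebra \<Omega> G P A)"
    by (rule depends_only_on_fixed_algebra_measurable[OF G A(2) hm])
  have "AE x in P. real_cond_exp P (fixed_algebra \<Omega> G P A) f x = h x"
  proof (rule F.real_cond_exp_charact[OF _ f hint hF])
    fix Y assume Y: "Y \<in> sets (fixed_algebra \<Omega> G P A)"
    then have [measurable]: "Y \<in> sets P" using F.subalg by (auto simp: subalgebra_def)
    have "indicat_real Y \<in> borel_measurable (fixed_algebra \<Omega> G P A)" using Y by simp
    from fixed_algebra_representative[OF G na A this]
    obtain k where [measurable]: "k \<in> borel_measurable P" and kdep: "depends_only_on (space P) A k"
      and k: "AE x in P. indicat_real Y x = k x" by blast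
    have kf: "integrable P (\<lambda>x. k x * f x)"
    proof (rule integrable_cong_AE_imp)
      show "integrable P (\<lambda>x. indicat_real Y x * f x)"
        using integrable_mult_indicator[OF _ f, of Y] by simp
      show "AE x in P. indicat_real Y x * f x = k x * f x" using k by eventually_elim simp
    qed simp
    have eq: "k (resample \<Omega> A (fst p) (snd p)) * f (resample \<Omega> A (fst p) (snd p))
        = k (fst p) * f (resample \<Omega> (A \<inter> B) (fst p) (snd p))" if "p \<in> space (P \<Otimes>\<^sub>M P)" for p
    proof -
      have xy: "fst p \<in> space P" "snd p \<in> space P" using that by (auto simp: space_pair_measure)
      note sp = resample_space[OF xy]
      have "\<forall>a\<in>A. resample \<Omega> A (fst p) (snd p) a = fst p a" using A by (auto simp: resample_def)
      then have "k (resample \<Omega> A (fst p) (snd p)) = k (fst p)"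
        using kdep sp xy unfolding depends_only_on_def by blast
      moreover have "\<forall>b\<in>B. resample \<Omega> A (fst p) (snd p) b = resample \<Omega> (A \<inter> B) (fst p) (snd p) b"
        using B by (auto simp: resample_def)
      then have "f (resample \<Omega> A (fst p) (snd p)) = f (resample \<Omega> (A \<inter> B) (fst p) (snd p))"
        using dep sp unfolding depends_only_on_def by blast
      ultimately show ?thesis by simp
    qed
    have intp: "integrable (P \<Otimes>\<^sub>M P) (\<lambda>p. k (fst p) * f (resample \<Omega> (A \<inter> B) (fst p) (snd p)))"
      by (rule iffD1[OF Bochner_Integration.integrable_cong intres[OF kf, of A]]) (simp_all add: eq)
    have "(\<integral>x\<in>Y. f x \<partial>P) = (\<integral>x. k x * f x \<partial>P)"
      unfolding set_lebesgue_integral_def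
      by (rule integral_cong_AE) (use k in \<open>auto elim: eventually_mono\<close>)
    also have "\<dots> = (\<integral>x. k x * f x \<partial>distr (P \<Otimes>\<^sub>M P) P (\<lambda>p. resample \<Omega> A (fst p) (snd p)))"
      by (simp add: dres)
    also have "\<dots> = (\<integral>p. k (resample \<Omega> A (fst p) (snd p)) * f (resample \<Omega> A (fst p) (snd p)) \<partial>(P \<Otimes>\<^sub>M P))"
      by (rule integral_distr) auto
    also have "\<dots> = (\<integral>p. k (fst p) * f (resample \<Omega> (A \<inter> B) (fst p) (snd p)) \<partial>(P \<Otimes>\<^sub>M P))"
      by (rule Bochner_Integration.integral_cong) (simp_all add: eq)
    also have "\<dots> = (\<integral>x. k x * h x \<partial>P)"
      using integral_fst'[OF intp] by (simp add: h_def)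
    also have "\<dots> = (\<integral>x\<in>Y. h x \<partial>P)"
      unfolding set_lebesgue_integral_def
      by (rule integral_cong_AE) (use k in \<open>auto elim: eventually_mono\<close>)
    finally show "(\<integral>x\<in>Y. f x \<partial>P) = (\<integral>x\<in>Y. h x \<partial>P)" .
  qed
  then show ?thesis by (simp add: h_def)
qed

lemma iid_dissociated:
  assumes G: "subgroup G (BijGroup \<Omega>)" and na: "no_algebraicity \<Omega> G"
  shows "dissociated \<Omega> G P"
  unfolding dissociated_def
proof (intro allI impI, elim conjE)
  fix A B and f :: "('w \<Rightarrow> 'z) \<Rightarrow> real"
  assume A: "finite A" "A \<subseteq> \<Omega>" and B: "finite B" "B \<subseteq> \<Omega>"
    and f: "f \<in> borel_measurable (fixed_algebra \<Omega> G P B)" and f2: "integrable P (\<lambda>x. (f x)\<^sup>2)"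
  have sub: "subalgebra P (fixed_algebra \<Omega> G P K)" for K
    by (rule subalgebra_fixed_algebra[OF G refl coord.P.prob_space_axioms])
  have fP [measurable]: "f \<in> borel_measurable P" using measurable_from_subalg[OF sub f] .
  have fint: "integrable P f" by (rule coord.P.square_integrable_imp_integrable[OF fP f2])
  obtain f' where f'm [measurable]: "f' \<in> borel_measurable P" and dep: "depends_only_on (space P) B f'"
    and ff': "AE x in P. f x = f' x"
    by (rule fixed_algebra_representative[OF G na B f])
  have f'int: "integrable P f'"
    by (rule integrable_cong_AE_imp[OF fint]) (use ff' in \<open>auto elim: eventually_mono\<close>)
  have cond: "AE x in P. real_cond_exp P (fixed_algebra \<Omega> G P K) f x =
      (\<integral>y. f' (resample \<Omega> (K \<inter> B) x y) \<partial>P)" if K: "finite K" "K \<subseteq> \<Omega>" for K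
  proof -
    interpret F: finite_measure_subalgebra P "fixed_algebra \<Omega> G P K"
      by unfold_locales (rule sub)
    show ?thesis
      using F.real_cond_exp_cong[OF ff' fP f'm] real_cond_exp_fixed_algebra[OF G na K B(2) f'int dep]
      by eventually_elim simp
  qed
  have cond_Int: "AE x in P. real_cond_exp P (fixed_algebra \<Omega> G P (A \<inter> B)) f x =
      (\<integral>y. f' (resample \<Omega> (A \<inter> B) x y) \<partial>P)"
    using cond[of "A \<inter> B"] A by (simp add: Int_assoc le_infI1)
  show "AE x in P. real_cond_exp P (fixed_algebra \<Omega> G P A) f x =
      real_cond_exp P (fixed_algebra \<Omega> G P (A \<inter> B)) f x"
    using cond[OF A] cond_Int by eventually_elim simp
qed

end

section \<open>Dissociated ergodic measures\<close>

text \<open>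
  Since \<open>\<F>\<^sub>\<emptyset>\<close> is trivial, the conditional expectation of the indicator of \<open>W\<close> given \<open>\<F>\<^sub>\<emptyset>\<close> is the constant \<open>\<mu> W\<close>;
  by dissociation it is also the conditional expectation given \<open>\<F>\<^sub>A\<close>.  Integrating over \<open>Y\<close> gives
  the product formula.
\<close>

lemma dissociated_independent:
  assumes G: "subgroup G (BijGroup \<Omega>)" and mu: "sets \<mu> = sets (Pi\<^sub>M \<Omega> (\<lambda>_. Z))"
    and prob: "prob_space \<mu>" and erg: "ergodic_measure \<Omega> G \<mu>" and dis: "dissociated \<Omega> G \<mu>"
    and A: "finite A" "A \<subseteq> \<Omega>" and B: "finite B" "B \<subseteq> \<Omega>" and disj: "A \<inter> B = {}"
    and Y: "Y \<in> fixed_sets \<Omega> G \<mu> A" and W: "W \<in> fixed_sets \<Omega> G \<mu> B"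
  shows "measure \<mu> (Y \<inter> W) = measure \<mu> Y * measure \<mu> W"
proof -
  interpret prob_space \<mu> by fact
  have F: "finite_measure_subalgebra \<mu> (fixed_algebra \<Omega> G \<mu> K)" for K
    by unfold_locales (rule subalgebra_fixed_algebra[OF G mu prob])
  interpret A: finite_measure_subalgebra \<mu> "fixed_algebra \<Omega> G \<mu> A" by (rule F)
  interpret E: finite_measure_subalgebra \<mu> "fixed_algebra \<Omega> G \<mu> {}" by (rule F)
  note sets = sets_fixed_algebra[OF G mu prob]
  have Ym [measurable]: "Y \<in> sets \<mu>" and Wm [measurable]: "W \<in> sets \<mu>"
    using Y W by (auto simp: fixed_sets_def)
  have int: "integrable \<mu> (indicat_real W)"
    by (intro integrable_real_indicator Wm) (simp add: emeasure_eq_measure)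
  have sq: "(\<lambda>x. (indicat_real W x)\<^sup>2) = indicat_real W"
    by (auto simp: indicator_def)
  have "AE x in \<mu>. real_cond_exp \<mu> (fixed_algebra \<Omega> G \<mu> {}) (indicat_real W) x = measure \<mu> W"
  proof (rule E.real_cond_exp_charact)
    fix V assume V: "V \<in> sets (fixed_algebra \<Omega> G \<mu> {})"
    then have V': "V \<in> fixed_sets \<Omega> G \<mu> {}" unfolding sets .
    then have Vm [measurable]: "V \<in> sets \<mu>" by (auto simp: fixed_sets_def)
    have "measure \<mu> V \<in> {0, 1}" using erg V' unfolding ergodic_measure_def by blast
    then have "measure \<mu> (V \<inter> W) = measure \<mu> V * measure \<mu> W"
    proof safe
      assume "measure \<mu> V = 0"
      then show ?thesis using finite_measure_mono[of "V \<inter> W" V] by (simp add: measure_le_0_iff)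
    next
      assume "measure \<mu> V = 1"
      then show ?thesis using measure_space_inter[of W V] prob_space by (simp add: Int_commute)
    qed
    then show "(\<integral>x\<in>V. indicat_real W x \<partial>\<mu>) = (\<integral>x\<in>V. measure \<mu> W \<partial>\<mu>)"
      by (simp add: set_lebesgue_integral_def indicator_inter_arith[symmetric])
  qed (simp_all add: int)
  moreover have "indicat_real W \<in> borel_measurable (fixed_algebra \<Omega> G \<mu> B)"
    by (intro borel_measurable_indicator) (simp add: sets W)
  then have "AE x in \<mu>. real_cond_exp \<mu> (fixed_algebra \<Omega> G \<mu> A) (indicat_real W) x =
      real_cond_exp \<mu> (fixed_algebra \<Omega> G \<mu> (A \<inter> B)) (indicat_real W) x"
    using dis A B int sq unfolding dissociated_def by simp
  ultimately have ce: "AE x in \<mu>. real_cond_exp \<mu> (fixed_algebra \<Omega> G \<mu> A) (indicat_real W) x = measure \<mu> W"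
    unfolding disj by eventually_elim simp
  have "measure \<mu> (Y \<inter> W) = (\<integral>x\<in>Y. indicat_real W x \<partial>\<mu>)"
    by (simp add: set_lebesgue_integral_def indicator_inter_arith[symmetric])
  also have "\<dots> = (\<integral>x\<in>Y. real_cond_exp \<mu> (fixed_algebra \<Omega> G \<mu> A) (indicat_real W) x \<partial>\<mu>)"
    using Y by (intro A.real_cond_exp_intA int) (simp add: sets)
  also have "\<dots> = (\<integral>x\<in>Y. measure \<mu> W \<partial>\<mu>)"
    unfolding set_lebesgue_integral_def
    by (rule integral_cong_AE) (use ce in \<open>auto elim: eventually_mono\<close>)
  also have "\<dots> = measure \<mu> Y * measure \<mu> W"
    by (simp add: set_lebesgue_integral_def)
  finally show ?thesis .
qed

lemma transitive_marginals:
  assumes G: "subgroup G (BijGroup \<Omega>)"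
    and trans: "transitive_action (perm_group \<Omega> G) \<Omega> (\<lambda>g. g)"
    and mu: "sets \<mu> = sets (Pi\<^sub>M \<Omega> (\<lambda>_. Z))" and inv: "action_invariant \<Omega> G \<mu>"
    and \<omega>: "\<omega> \<in> \<Omega>" "\<omega>' \<in> \<Omega>" and S: "S \<in> sets Z"
  shows "measure \<mu> {x \<in> space \<mu>. x \<omega> \<in> S} = measure \<mu> {x \<in> space \<mu>. x \<omega>' \<in> S}"
proof -
  obtain g where g: "g \<in> G" "g \<omega>' = \<omega>"
    using transitive_action.unique_orbit[OF trans \<omega>(2,1)] by (auto simp: perm_group_def)
  have gB: "g \<in> Bij \<Omega>" using g subgroup.subset[OF G] by (auto simp: BijGroup_def)
  have gm: "coord_action \<Omega> g \<in> \<mu> \<rightarrow>\<^sub>M \<mu>"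
    using coord_action_measurable[OF gB, of Z] measurable_cong_sets[OF mu mu] by simp
  have ginv: "inv_into \<Omega> g \<omega> = \<omega>'" using g gB \<omega> by (auto simp: Bij_def bij_betw_def inv_into_f_f)
  have T: "{x \<in> space \<mu>. x \<omega> \<in> S} \<in> sets \<mu>"
  proof -
    have "{x \<in> space (Pi\<^sub>M \<Omega> (\<lambda>_. Z)). x \<omega> \<in> S} \<in> sets (Pi\<^sub>M \<Omega> (\<lambda>_. Z))"
      using \<omega> S by measurable
    then show ?thesis using mu sets_eq_imp_space_eq[OF mu] by simp
  qed
  have "measure \<mu> {x \<in> space \<mu>. x \<omega> \<in> S}
      = measure (distr \<mu> \<mu> (coord_action \<Omega> g)) {x \<in> space \<mu>. x \<omega> \<in> S}"
    using inv g by (simp add: action_invariant_def)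
  also have "\<dots> = measure \<mu> (coord_action \<Omega> g -` {x \<in> space \<mu>. x \<omega> \<in> S} \<inter> space \<mu>)"
    by (rule measure_distr[OF gm T])
  also have "coord_action \<Omega> g -` {x \<in> space \<mu>. x \<omega> \<in> S} \<inter> space \<mu> = {x \<in> space \<mu>. x \<omega>' \<in> S}"
    using measurable_space[OF gm] \<omega> by (auto simp: coord_action_def ginv)
  finally show ?thesis .
qed

text \<open>
  Cylinders over disjoint finite sets are independent, so cylinder probabilities factorize by
  induction on the number of coordinates; the cylinders determine the measure.
\<close>

lemma dissociated_imp_iid:
  assumes G: "subgroup G (BijGroup \<Omega>)"
    and trans: "transitive_action (perm_group \<Omega> G) \<Omega> (\<lambda>g. g)"
    and mu: "sets \<mu> = sets (Pi\<^sub>M \<Omega> (\<lambda>_. Z))" and prob: "prob_space \<mu>"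
    and inv: "action_invariant \<Omega> G \<mu>" and erg: "ergodic_measure \<Omega> G \<mu>"
    and dis: "dissociated \<Omega> G \<mu>" and \<omega>\<^sub>0: "\<omega>\<^sub>0 \<in> \<Omega>"
  shows "\<mu> = Pi\<^sub>M \<Omega> (\<lambda>_. distr \<mu> Z (\<lambda>x. x \<omega>\<^sub>0))"
proof -
  interpret prob_space \<mu> by fact
  let ?\<nu> = "distr \<mu> Z (\<lambda>x. x \<omega>\<^sub>0)"
  have sp: "space \<mu> = space (Pi\<^sub>M \<Omega> (\<lambda>_. Z))" by (rule sets_eq_imp_space_eq[OF mu])
  have pr: "(\<lambda>x. x \<omega>) \<in> \<mu> \<rightarrow>\<^sub>M Z" if "\<omega> \<in> \<Omega>" for \<omega>
    using measurable_component_singleton[OF that, of "\<lambda>_. Z"] measurable_cong_sets[OF mu refl] by blast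
  interpret \<nu>: prob_space ?\<nu> by (rule prob_space_distr[OF pr[OF \<omega>\<^sub>0]])
  interpret prod: product_prob_space "\<lambda>_. ?\<nu>" \<Omega> by unfold_locales
  have marg: "measure \<mu> {x \<in> space \<mu>. x \<omega> \<in> S} = measure ?\<nu> S" if "\<omega> \<in> \<Omega>" "S \<in> sets Z" for \<omega> S
    using transitive_marginals[OF G trans mu inv that(1) \<omega>\<^sub>0 that(2)]
      measure_distr[OF pr[OF \<omega>\<^sub>0] that(2)]
    by (simp add: vimage_def Int_def conj_commute)
  have cyl: "{x \<in> space \<mu>. \<forall>j\<in>J. x j \<in> S j} \<in> fixed_sets \<Omega> G \<mu> J"
    if J: "finite J" "J \<subseteq> \<Omega>" and S: "\<And>j. j \<in> J \<Longrightarrow> S j \<in> sets Z" for J S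
  proof (rule depends_only_on_in_fixed_sets[OF G mu J(2)])
    show "{x \<in> space \<mu>. \<forall>j\<in>J. x j \<in> S j} \<in> sets \<mu>"
      using J S by (intro sets.sets_Collect_finite_All measurable_sets_Collect[OF pr]) auto
    show "depends_only_on (space \<mu>) J (\<lambda>x. x \<in> {x \<in> space \<mu>. \<forall>j\<in>J. x j \<in> S j})"
      by (auto simp: depends_only_on_def)
  qed
  have indep: "measure \<mu> {x \<in> space \<mu>. \<forall>j\<in>J. x j \<in> S j} = (\<Prod>j\<in>J. measure ?\<nu> (S j))"
    if "finite J" "J \<subseteq> \<Omega>" "\<And>j. j \<in> J \<Longrightarrow> S j \<in> sets Z" for J S
    using that
  proof (induction J rule: finite_induct)
    case empty
    then show ?case by (simp add: prob_space)
  next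
    case (insert i J)
    have "{x \<in> space \<mu>. \<forall>j\<in>insert i J. x j \<in> S j}
        = {x \<in> space \<mu>. \<forall>j\<in>{i}. x j \<in> S j} \<inter> {x \<in> space \<mu>. \<forall>j\<in>J. x j \<in> S j}" by auto
    then have "measure \<mu> {x \<in> space \<mu>. \<forall>j\<in>insert i J. x j \<in> S j}
        = measure \<mu> {x \<in> space \<mu>. \<forall>j\<in>{i}. x j \<in> S j} * measure \<mu> {x \<in> space \<mu>. \<forall>j\<in>J. x j \<in> S j}"
      using insert by (simp only:) (intro dissociated_independent[OF G mu prob erg dis, of "{i}" J] cyl; auto)
    then show ?case using insert marg[of i "S i"] by simp
  qed
  show ?thesis
  proof (rule prod.PiM_eq)
    show "sets \<mu> = sets (Pi\<^sub>M \<Omega> (\<lambda>_. ?\<nu>))"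
      unfolding mu by (rule sets_PiM_cong) auto
    fix J S assume J: "finite J" "J \<subseteq> \<Omega>" "\<And>j. j \<in> J \<Longrightarrow> S j \<in> sets ?\<nu>"
    have "prod_emb \<Omega> (\<lambda>_. ?\<nu>) J (Pi\<^sub>E J S) = {x \<in> space \<mu>. \<forall>j\<in>J. x j \<in> S j}"
      using J(2) unfolding sp by (auto simp: prod_emb_def space_PiM PiE_iff extensional_def)
    then show "emeasure \<mu> (prod_emb \<Omega> (\<lambda>_. ?\<nu>) J (Pi\<^sub>E J S)) = (\<Prod>j\<in>J. emeasure ?\<nu> (S j))"
      using indep[of J S] J
      by (simp add: emeasure_eq_measure \<nu>.emeasure_eq_measure prod_ennreal)
  qed
qed

section \<open>The equivalence\<close>

theorem corollary3p6:
  fixes \<Omega> :: "'w set" and G :: "('w \<Rightarrow> 'w) set"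
    and Z :: "'z measure" and \<mu> :: "('w \<Rightarrow> 'z) measure"
  assumes "countable \<Omega>" and "infinite \<Omega>"
    and "closed_permutation_group \<Omega> G"
    and "transitive_action (perm_group \<Omega> G) \<Omega> (\<lambda>g. g)"
    and "no_algebraicity \<Omega> G"
    and "standard_borel Z"
    and "prob_space \<mu>" and "sets \<mu> = sets (Pi\<^sub>M \<Omega> (\<lambda>_. Z))"
    and "action_invariant \<Omega> G \<mu>"
    and "ergodic_measure \<Omega> G \<mu>"
  shows "dissociated \<Omega> G \<mu> \<longleftrightarrow>
    (\<exists>\<nu> :: 'z measure. prob_space \<nu> \<and> sets \<nu> = sets Z \<and> \<mu> = Pi\<^sub>M \<Omega> (\<lambda>_. \<nu>))"
proof
  have G: "subgroup G (BijGroup \<Omega>)"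
    using assms(3) by (simp add: closed_permutation_group_def)
  {
    assume dis: "dissociated \<Omega> G \<mu>"
    obtain \<omega> where \<omega>: "\<omega> \<in> \<Omega>" using \<open>infinite \<Omega>\<close> by (auto dest: infinite_imp_nonempty)
    let ?\<nu> = "distr \<mu> Z (\<lambda>x. x \<omega>)"
    have "(\<lambda>x. x \<omega>) \<in> \<mu> \<rightarrow>\<^sub>M Z"
      using measurable_component_singleton[OF \<omega>, of "\<lambda>_. Z"] measurable_cong_sets[OF assms(8) refl]
      by blast
    then have "prob_space ?\<nu>" by (rule prob_space.prob_space_distr[OF assms(7)])
    moreover have "\<mu> = Pi\<^sub>M \<Omega> (\<lambda>_. ?\<nu>)"
      by (rule dissociated_imp_iid[OF G assms(4,8,7,9,10) dis \<omega>])
    ultimately show "\<exists>\<nu> :: 'z measure. prob_space \<nu> \<and> sets \<nu> = sets Z \<and> \<mu> = Pi\<^sub>M \<Omega> (\<lambda>_. \<nu>)"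
      by (intro exI[of _ ?\<nu>]) auto
  }
  {
    assume "\<exists>\<nu> :: 'z measure. prob_space \<nu> \<and> sets \<nu> = sets Z \<and> \<mu> = Pi\<^sub>M \<Omega> (\<lambda>_. \<nu>)"
    then obtain \<nu> :: "'z measure" where \<nu>: "prob_space \<nu>" "\<mu> = Pi\<^sub>M \<Omega> (\<lambda>_. \<nu>)" by blast
    interpret iid_coordinates \<nu> \<Omega> by (rule iid_coordinates.intro[OF \<nu>(1)])
    show "dissociated \<Omega> G \<mu>" unfolding \<nu>(2) by (rule iid_dissociated[OF G assms(5)])
  }
qed

end
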